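(* Let $\alpha\in(0,1)$, let $\delta$ be a bounding function, and let $(\beta_{n,\alpha})_{n\ge 1}$ be a bounding sequence for $\delta$ at level $\alpha$. Let $P_1,\dots,P_n$ be independent $p$-values with $P_i\sim G_{\theta_i}$, let $\lambda=n^{-1}\sum_{i=1}^n \mathbf 1\{\theta_i\neq 0\}$ be the proportion of false null hypotheses, let $F_n(t)=n^{-1}\sum_{i=1}^n\mathbf 1\{P_i\le t\}$, and let $$\hat\lambda=\sup_{t\in(0,1)}\frac{F_n(t)-t-\beta_{n,\alpha}\,\delta(t)}{1-t}.$$ Then $$P(\hat\lambda\le\lambda)\ge 1-\alpha.$$
   Context: Model: $\{G_\theta:\theta\in\Theta\}$ is a family of distributions on $[0,1]$ (distributions of $p$-values), where $\Theta$ is possibly infinite-dimensional, $0\in\Theta$, and $G_0(t)=t$ is the uniform distribution on $[0,1]$. The parameters $\theta_1,\dots,\theta_n\in\Theta$ are fixed (unknown); the $i$-th null hypothesis is true if $\theta_i=0$ and false otherwise. Bounding function: any real-valued function $\delta$ on $[0,1]$ that is strictly positive on $(0,1)$. For $n\ge1$ let $U_n(t)$ be the empirical cumulative distribution function of $n$ independent random variables uniform on $[0,1]$, and set $$V_{n,\delta}:=\sup_{t\in(0,1)}\frac{U_n(t)-t}{\delta(t)}.$$ Bounding sequence: a series of real numbers $\beta_{n,\alpha}$, $n\ge1$, is called a bounding sequence for the bounding function $\delta$ at the (constant) level $\alpha$ if (a) $n\beta_{n,\alpha}$ is monotonically increasing with $n$; and (b) $P(V_{n,\delta}>\beta_{n,\alpha})<\alpha$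 for all $n$. *)

theory Defs
  imports "HOL-Probability.Probability"
begin

text \<open>
  The family of p-value distributions \<open>G\<close>, indexed by the set \<open>\<Theta>\<close> of parameters. Each \<open>G \<theta>\<close> is a
  Borel probability measure on the reals carried by \<open>[0,1]\<close>; the notation \<open>G\<^sub>0(t) = t\<close> refers to its
  distribution function.
\<close>
definition pvalue_model :: "'p::zero set \<Rightarrow> ('p \<Rightarrow> real measure) \<Rightarrow> bool" where
  "pvalue_model \<Theta> G \<longleftrightarrow>
     0 \<in> \<Theta> \<and>
     (\<forall>\<theta>\<in>\<Theta>. real_distribution (G \<theta>) \<and> measure (G \<theta>) {0..1} = 1) \<and>
     (\<forall>t\<in>{0..1}. cdf (G 0) t = t)"

text \<open>
  Only the restriction to \<open>[0,1]\<close> is meaningful. Neither continuity nor measurability is assumed.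
\<close>
definition bounding_function :: "(real \<Rightarrow> real) \<Rightarrow> bool" where
  "bounding_function \<delta> \<longleftrightarrow> (\<forall>t\<in>{0<..<1}. \<delta> t > 0)"

definition emp_cdf :: "nat \<Rightarrow> (nat \<Rightarrow> real) \<Rightarrow> real \<Rightarrow> real" where
  "emp_cdf n x t = (\<Sum>i=1..n. of_bool (x i \<le> t)) / real n"

text \<open>
  The supremum is taken in the extended reals, since it may be infinite if \<open>\<delta>\<close> is not bounded away
  from \<open>0\<close>.
\<close>
definition V_stat :: "nat \<Rightarrow> (real \<Rightarrow> real) \<Rightarrow> (nat \<Rightarrow> real) \<Rightarrow> ereal" where
  "V_stat n \<delta> x = (SUP t\<in>{0<..<1}. ereal ((emp_cdf n x t - t) / \<delta> t))"

text \<open>The joint law of \<open>n\<close> independent random variables uniform on \<open>[0,1]\<close>.\<close>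
definition uniform_sample :: "nat \<Rightarrow> (nat \<Rightarrow> real) measure" where
  "uniform_sample n = PiM {1..n} (\<lambda>_. uniform_measure lborel {0..1})"

text \<open>
  The event below is measurable for arbitrary \<open>\<delta>\<close>: it is the finite union, over \<open>S \<subseteq> {1..n}\<close>, of the
  events that some \<open>t\<close> with \<open>t + \<beta> n * \<delta> t < card S / n\<close> dominates all \<open>x i\<close>, \<open>i \<in> S\<close>, and each of
  these only requires the maximum of the \<open>x i\<close> to lie in a certain interval.
\<close>
definition bounding_sequence :: "(real \<Rightarrow> real) \<Rightarrow> real \<Rightarrow> (nat \<Rightarrow> real) \<Rightarrow> bool" where
  "bounding_sequence \<delta> \<alpha> \<beta> \<longleftrightarrow>
     mono_on {1..} (\<lambda>n. real n * \<beta> n) \<and>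
     (\<forall>n\<ge>1. measure (uniform_sample n)
        {x \<in> space (uniform_sample n). V_stat n \<delta> x > ereal (\<beta> n)} < \<alpha>)"

definition false_null_proportion :: "nat \<Rightarrow> (nat \<Rightarrow> 'p::zero) \<Rightarrow> real" where
  "false_null_proportion n \<theta> = (\<Sum>i=1..n. of_bool (\<theta> i \<noteq> 0)) / real n"

definition lambda_hat :: "nat \<Rightarrow> (real \<Rightarrow> real) \<Rightarrow> (nat \<Rightarrow> real) \<Rightarrow> (nat \<Rightarrow> real) \<Rightarrow> ereal" where
  "lambda_hat n \<delta> \<beta> p =
     (SUP t\<in>{0<..<1}. ereal ((emp_cdf n p t - t - \<beta> n * \<delta> t) / (1 - t)))"

end

theory Submission
  imports Defs
begin

text \<open>
  Let \<open>m\<close> be the number of true nulls. Bounding the indicators of the false nulls by \<open>1\<close> gives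
  \<open>n F\<^sub>n(t) \<le> (n - m) + m U\<^sub>m(t)\<close>, where \<open>U\<^sub>m\<close> is the empirical distribution function of the \<open>m\<close> uniform
  p-values. Off an event of probability less than \<open>\<alpha>\<close>,
  \<open>m (U\<^sub>m(t) - t) \<le> m \<beta>\<^sub>m \<delta>(t) \<le> n \<beta>\<^sub>n \<delta>(t)\<close> by monotonicity of \<open>n \<beta>\<^sub>n\<close>, and with \<open>n \<lambda> = n - m\<close> this
  rearranges to \<open>F\<^sub>n(t) - t - \<beta>\<^sub>n \<delta>(t) \<le> \<lambda> (1 - t)\<close>. The case \<open>m = 0\<close>, about which the bounding
  sequence says nothing directly, needs \<open>\<beta>\<^sub>n \<ge> 0\<close>.
\<close>

text \<open>Serves to renumber the true nulls by \<open>{1..m}\<close>. An injective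
  \<open>f\<close> maps each finite \<open>J\<close> one-to-one onto \<open>f\<close>
  J\<open>, so the product formula over\<close>f \<open>J\<close> is the one over
  \<open>J\<close>.\<close>

lemma (in prob_space) indep_vars_reindex:
  assumes indep: "indep_vars M' X (f ` I)" and inj: "inj_on f I"
  shows "indep_vars (\<lambda>i. M' (f i)) (\<lambda>i. X (f i)) I"
  unfolding indep_vars_def2
proof (intro conjI ballI indep_setsI)
  fix i assume "i \<in> I"
  then show rv: "random_variable (M' (f i)) (X (f i))"
    using indep by (auto simp: indep_vars_def2)
  show "{X (f i) -` A \<inter> space M |A. A \<in> sets (M' (f i))} \<subseteq> events"
    using rv by (auto intro: measurable_sets)
next
  fix A J
  assume J: "J \<noteq> {}" "J \<subseteq> I" "finite J"
    and A: "\<forall>j\<in>J. A j \<in> {X (f j) -` B \<inter> space M |B. B \<in> sets (M' (f j))}"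
  have injJ: "inj_on f J"
    using inj J(2) by (rule inj_on_subset)
  define A' where "A' = (\<lambda>k. A (the_inv_into J f k))"
  have A': "A' (f j) = A j" if "j \<in> J" for j
    using that injJ by (simp add: A'_def the_inv_into_f_f)
  have "prob (\<Inter>k\<in>f ` J. A' k) = (\<Prod>k\<in>f ` J. prob (A' k))"
    using indep J A A' unfolding indep_vars_def2
    by (intro indep_setsD[where I = "f ` I"]) auto
  then show "prob (\<Inter>j\<in>J. A j) = (\<Prod>j\<in>J. prob (A j))"
    by (simp add: prod.reindex[OF injJ] A')
qed

text \<open>Covers the events of both \<open>V_stat\<close> and \<open>lambda_hat\<close>, which
  differ only in \<open>h\<close>. Since \<open>h\<close> is arbitrary, \<open>t\<close> cannot be
  restricted to a countable set; the event is instead a finite union over the sets \<open>S\<close>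
  of indices required to satisfy \<open>X i \<omega> \<le> t\<close>.\<close>

lemma sets_ex_less_count:
  fixes X :: "'i \<Rightarrow> 'a \<Rightarrow> real" and T :: "real set" and h :: "real \<Rightarrow> real"
  assumes "finite I" and X: "\<And>i. i \<in> I \<Longrightarrow> X i \<in> borel_measurable M"
  shows "{\<omega> \<in> space M. \<exists>t\<in>T. h t < (\<Sum>i\<in>I. of_bool (X i \<omega> \<le> t))} \<in> sets M"
proof -
  define D where "D k = {y. \<exists>t\<in>T. h t < real k \<and> y \<le> t}" for k
  have D: "D k \<in> sets borel" for k
    by (intro real_interval_borel_measurable)
      (auto simp: D_def is_interval_1 intro: order_trans)
  define E where "E S = {\<omega> \<in> space M. \<exists>t\<in>T. h t < real (card S) \<and> (\<forall>i\<in>S. X i \<omega> \<le> t)}" for S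
  \<comment> \<open>\<open>D k\<close> is downward closed, so \<open>E S\<close> says that each \<open>X i\<close> with \<open>i \<in> S\<close> lies in \<open>D (card S)\<close>:
    the witness for the largest \<open>X i\<close> serves all of them.\<close>
  have E: "E S \<in> sets M" if S: "S \<subseteq> I" for S
  \<comment> \<open>For empty \<open>S\<close> the event is \<open>{}\<close> or
    \<open>space M\<close>; there is no maximum to take, and an intersection over no index would be
    \<open>UNIV\<close>.\<close>
  proof (cases "S = {}")
    case True
    then show ?thesis by (simp add: E_def)
  next
    case False
    have finS: "finite S"
      using S \<open>finite I\<close> by (rule finite_subset)
    have "E S = (\<Inter>i\<in>S. X i -` D (card S) \<inter> space M)"
    proof (intro equalityI subsetI)
      fix \<omega> assume "\<omega> \<in> E S"
      then show "\<omega> \<in> (\<Inter>i\<in>S. X i -` D (card S) \<inter> space M)"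
        by (auto simp: E_def D_def)
    next
      fix \<omega> assume \<omega>: "\<omega> \<in> (\<Inter>i\<in>S. X i -` D (card S) \<inter> space M)"
      have "Max ((\<lambda>i. X i \<omega>) ` S) \<in> (\<lambda>i. X i \<omega>) ` S"
        using finS False by (intro Max_in) auto
      then have "Max ((\<lambda>i. X i \<omega>) ` S) \<in> D (card S)"
        using \<omega> False by auto
      then obtain t where t: "t \<in> T" "h t < real (card S)" "Max ((\<lambda>i. X i \<omega>) ` S) \<le> t"
        by (auto simp: D_def)
      have "X i \<omega> \<le> t" if "i \<in> S" for i
        using that finS by (intro order_trans[OF Max_ge t(3)]) auto
      then show "\<omega> \<in> E S"
        using t \<omega> False by (auto simp: E_def)
    qed
    also have "\<dots> \<in> sets M"
      using finS False S D by (intro sets.finite_INT) (auto intro!: measurable_sets[OF X])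
    finally show ?thesis .
  qed
  have count: "(\<Sum>i\<in>I. of_bool (X i \<omega> \<le> t)) = real (card {i\<in>I. X i \<omega> \<le> t})" for \<omega> t
    using \<open>finite I\<close> by (simp add: of_bool_def sum.If_cases Int_def)
  \<comment> \<open>One inclusion takes for \<open>S\<close> all indices counted at
    \<open>t\<close>. Conversely, any \<open>S\<close> of counted indices has at most as many
    elements as the count.\<close>
  have "{\<omega> \<in> space M. \<exists>t\<in>T. h t < (\<Sum>i\<in>I. of_bool (X i \<omega> \<le> t))} = (\<Union>S\<in>Pow I. E S)"
  proof (intro equalityI subsetI)
    fix \<omega> assume "\<omega> \<in> {\<omega> \<in> space M. \<exists>t\<in>T. h t < (\<Sum>i\<in>I. of_bool (X i \<omega> \<le> t))}"
    then obtain t where "\<omega> \<in> space M" "t \<in> T" "h t < real (card {i\<in>I. X i \<omega> \<le> t})"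
      by (auto simp: count)
    then have "\<omega> \<in> E {i\<in>I. X i \<omega> \<le> t}"
      by (auto simp: E_def)
    then show "\<omega> \<in> (\<Union>S\<in>Pow I. E S)"
      by (rule UN_I[rotated]) auto
  next
    fix \<omega> assume "\<omega> \<in> (\<Union>S\<in>Pow I. E S)"
    then obtain S t where St: "S \<subseteq> I" "\<omega> \<in> space M" "t \<in> T" "h t < real (card S)"
      "\<forall>i\<in>S. X i \<omega> \<le> t"
      by (auto simp: E_def)
    have "card S \<le> card {i\<in>I. X i \<omega> \<le> t}"
      using St \<open>finite I\<close> by (intro card_mono) auto
    with St show "\<omega> \<in> {\<omega> \<in> space M. \<exists>t\<in>T. h t < (\<Sum>i\<in>I. of_bool (X i \<omega> \<le> t))}"
      by (auto simp: count intro!: bexI[of _ t])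
  qed
  also have "\<dots> \<in> sets M"
    using \<open>finite I\<close> E by (intro sets.finite_UN) auto
  finally show ?thesis .
qed

text \<open>A supremum exceeds a bound exactly when some member does, attained or not. Clearing the
  positive denominators \<open>real n\<close> and \<open>\<delta> t\<close> gives the form treated
  by \<open>sets_ex_less_count\<close>.\<close>

lemma V_stat_gt_iff:
  assumes "bounding_function \<delta>" "n \<ge> 1"
  shows "V_stat n \<delta> x > ereal b \<longleftrightarrow>
    (\<exists>t\<in>{0<..<1}. real n * (t + b * \<delta> t) < (\<Sum>i\<in>{1..n}. of_bool (x i \<le> t)))"
  unfolding V_stat_def less_SUP_iff emp_cdf_def
  using assms by (intro bex_cong) (auto simp: bounding_function_def field_simps)

lemma lambda_hat_le_iff:
  assumes "n \<ge> 1"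
  shows "lambda_hat n \<delta> \<beta> x \<le> ereal l \<longleftrightarrow>
    \<not> (\<exists>t\<in>{0<..<1}. real n * (t + \<beta> n * \<delta> t + l * (1 - t)) < (\<Sum>i\<in>{1..n}. of_bool (x i \<le> t)))"
proof -
  have "ereal l < lambda_hat n \<delta> \<beta> x \<longleftrightarrow>
    (\<exists>t\<in>{0<..<1}. real n * (t + \<beta> n * \<delta> t + l * (1 - t)) < (\<Sum>i\<in>{1..n}. of_bool (x i \<le> t)))"
    unfolding lambda_hat_def less_SUP_iff emp_cdf_def
    using assms by (intro bex_cong) (auto simp: field_simps)
  then show ?thesis
    by (simp add: not_less[symmetric])
qed

lemma prob_space_unit_uniform: "prob_space (uniform_measure lborel {0..1::real})"
  by (intro prob_space_uniform_measure) auto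

lemma sets_V_stat_gt:
  assumes "bounding_function \<delta>" "n \<ge> 1"
  shows "{x \<in> space (uniform_sample n). V_stat n \<delta> x > ereal b} \<in> sets (uniform_sample n)"
proof -
  have "(\<lambda>x. x i) \<in> borel_measurable (uniform_sample n)" if "i \<in> {1..n}" for i
    using measurable_component_singleton[OF that, of "\<lambda>_. uniform_measure lborel {0..1::real}"]
    by (simp add: uniform_sample_def cong: measurable_cong_sets)
  then show ?thesis
    unfolding V_stat_gt_iff[OF assms] by (intro sets_ex_less_count) auto
qed

text \<open>The model fixes the cdf only on [0,1], but its end values 0 and 1 force it to be
  constant on either side, and a cdf determines the law.\<close>

lemma pvalue_model_null:
  assumes "pvalue_model \<Theta> G"
  shows "G 0 = uniform_measure lborel {0..1}"
proof (rule cdf_unique)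
  show G0: "real_distribution (G 0)"
    using assms by (simp add: pvalue_model_def)
  interpret G: real_distribution "G 0" by fact
  interpret U: prob_space "uniform_measure lborel {0..1::real}"
    by (rule prob_space_unit_uniform)
  show "real_distribution (uniform_measure lborel {0..1::real})"
    by unfold_locales simp_all
  have cdf: "cdf (G 0) t = t" if "0 \<le> t" "t \<le> 1" for t
    using assms that by (simp add: pvalue_model_def)
  show "cdf (G 0) = cdf (uniform_measure lborel {0..1})"
  proof
    fix t :: real
    have U: "cdf (uniform_measure lborel {0..1}) t = measure lborel ({0..1} \<inter> {..t})"
      unfolding cdf_def by simp
    consider "t < 0" | "0 \<le> t" "t \<le> 1" | "1 < t" by linarith
    then show "cdf (G 0) t = cdf (uniform_measure lborel {0..1}) t"
    proof cases
      case 1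
      then have "{0..1} \<inter> {..t} = {}" by auto
      moreover have "cdf (G 0) t = 0"
        using G.cdf_nondecreasing[of t 0] cdf[of 0] G.cdf_nonneg[of t] 1 by simp
      ultimately show ?thesis by (simp add: U)
    next
      case 2
      then have "{0..1} \<inter> {..t} = {0..t}" by auto
      with 2 show ?thesis by (simp add: U cdf)
    next
      case 3
      then have "{0..1} \<inter> {..t} = {0..1}" by auto
      moreover have "cdf (G 0) t = 1"
        using G.cdf_nondecreasing[of 1 t] cdf[of 1] G.cdf_bounded_prob[of t] 3 by simp
      ultimately show ?thesis by (simp add: U)
    qed
  qed
qed

text \<open>
  Almost surely all observations are below some \<open>t < 1\<close>, and there the empirical distribution
  function exceeds \<open>t\<close>, so \<open>V_stat\<close> is positive almost surely and a negative \<open>\<beta> n\<close> would be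
  exceeded with probability \<open>1 > \<alpha>\<close>.
\<close>
lemma bounding_sequence_nonneg:
  assumes \<delta>: "bounding_function \<delta>" and \<beta>: "bounding_sequence \<delta> \<alpha> \<beta>"
    and "\<alpha> < 1" and n: "n \<ge> 1"
  shows "\<beta> n \<ge> 0"
proof (rule ccontr)
  assume "\<not> \<beta> n \<ge> 0"
  then have neg: "\<beta> n < 0" by simp
  let ?U = "uniform_measure lborel {0..1::real}"
  interpret S: prob_space "uniform_sample n"
    unfolding uniform_sample_def by (intro prob_space_PiM prob_space_unit_uniform)
  have below: "AE y in ?U. y < 1"
    using AE_lborel_singleton[of "1::real"] by (intro AE_uniform_measureI) auto
  have "AE x in uniform_sample n. \<forall>i\<in>{1..n}. x i < 1"
    unfolding uniform_sample_def
    by (intro AE_finite_allI finite_atLeastAtMost AE_PiM_component prob_space_unit_uniform below) auto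
  moreover have "V_stat n \<delta> x > ereal (\<beta> n)" if x: "\<forall>i\<in>{1..n}. x i < 1" for x
  proof -
    \<comment> \<open>Inserting 0 makes \<open>t\<close> positive, so that
      \<open>\<delta> t > 0\<close> is available.\<close>
    have "Max (insert 0 (x ` {1..n})) < 1"
      using x by (subst Max_less_iff) auto
    then obtain t where t: "Max (insert 0 (x ` {1..n})) < t" "t < 1"
      using dense by blast
    then have t0: "0 < t" and xt: "\<forall>i\<in>{1..n}. x i < t"
      by (simp_all add: Max_less_iff)
    have "\<beta> n * \<delta> t < 0"
      using neg \<delta> t0 t by (simp add: bounding_function_def mult_neg_pos)
    then have "real n * (t + \<beta> n * \<delta> t) < real n * 1"
      using t n by (intro mult_strict_left_mono) auto
    also have "\<dots> = (\<Sum>i\<in>{1..n}. of_bool (x i \<le> t))"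
      using xt by (simp add: less_imp_le)
    finally show ?thesis
      using t0 t by (auto simp: V_stat_gt_iff[OF \<delta> n])
  qed
  ultimately have "AE x in uniform_sample n. V_stat n \<delta> x > ereal (\<beta> n)"
    by (auto elim: eventually_mono)
  then have "S.prob {x \<in> space (uniform_sample n). V_stat n \<delta> x > ereal (\<beta> n)} = 1"
    by (subst S.prob_Collect_eq_1) (auto intro: sets_V_stat_gt[OF \<delta> n])
  with \<beta> n \<open>\<alpha> < 1\<close> show False
    by (auto simp: bounding_sequence_def)
qed

text \<open>For a nonempty index set, independence means that the joint law is the product of the
  marginals. This transfers the bounding property at sample size \<open>m\<close> to the null
  p-values.\<close>

lemma (in prob_space) distr_uniform_sample:
  assumes indep: "indep_vars (\<lambda>_. borel) X {1..m}" and "m \<ge> 1"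
    and unif: "\<And>i. i \<in> {1..m} \<Longrightarrow> distr M borel (X i) = uniform_measure lborel {0..1}"
  shows "distr M (PiM {1..m} (\<lambda>_. borel)) (\<lambda>\<omega>. \<lambda>i\<in>{1..m}. X i \<omega>) = uniform_sample m"
proof -
  have rv: "X i \<in> borel_measurable M" if "i \<in> {1..m}" for i
    using indep that by (auto simp: indep_vars_def2)
  have "distr M (PiM {1..m} (\<lambda>_. borel)) (\<lambda>\<omega>. \<lambda>i\<in>{1..m}. X i \<omega>)
      = PiM {1..m} (\<lambda>i. distr M borel (X i))"
    using \<open>m \<ge> 1\<close> rv indep by (subst indep_vars_iff_distr_eq_PiM'[symmetric]) auto
  also have "\<dots> = uniform_sample m"
    unfolding uniform_sample_def by (intro PiM_cong unif refl)
  finally show ?thesis .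
qed

theorem theorem1:
  fixes \<Theta> :: "'p::zero set" and G :: "'p \<Rightarrow> real measure"
    and \<theta> :: "nat \<Rightarrow> 'p" and n :: nat
    and \<alpha> :: real and \<delta> :: "real \<Rightarrow> real" and \<beta> :: "nat \<Rightarrow> real"
    and M :: "'a measure" and P :: "nat \<Rightarrow> 'a \<Rightarrow> real"
  assumes "pvalue_model \<Theta> G"
    and "0 < \<alpha>" "\<alpha> < 1"
    and "bounding_function \<delta>"
    and "bounding_sequence \<delta> \<alpha> \<beta>"
    and "n \<ge> 1"
    and "\<And>i. i \<in> {1..n} \<Longrightarrow> \<theta> i \<in> \<Theta>"
    and "prob_space M"
    and "prob_space.indep_vars M (\<lambda>_. borel) P {1..n}"
    and "\<And>i. i \<in> {1..n} \<Longrightarrow> distr M borel (P i) = G (\<theta> i)"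
  shows "measure M {\<omega> \<in> space M.
           lambda_hat n \<delta> \<beta> (\<lambda>i. P i \<omega>) \<le> ereal (false_null_proportion n \<theta>)} \<ge> 1 - \<alpha>"
proof -
  interpret prob_space M by fact
  let ?L = "false_null_proportion n \<theta>"
  let ?good = "{\<omega> \<in> space M. lambda_hat n \<delta> \<beta> (\<lambda>i. P i \<omega>) \<le> ereal ?L}"
  define I where "I = {i\<in>{1..n}. \<theta> i = 0}"
  define m where "m = card I"
  have I: "finite I" "I \<subseteq> {1..n}" by (auto simp: I_def)
  have rv: "P i \<in> borel_measurable M" if "i \<in> {1..n}" for i
    using assms(9) that by (auto simp: indep_vars_def2)
  \<comment> \<open>Monotonicity of the measure, used at the end, requires the larger set to be
    measurable.\<close>
  have good: "?good \<in> events"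
  proof -
    have "{\<omega> \<in> space M. \<exists>t\<in>{0<..<1}. real n * (t + \<beta> n * \<delta> t + ?L * (1 - t))
        < (\<Sum>i\<in>{1..n}. of_bool (P i \<omega> \<le> t))} \<in> events"
      using rv by (intro sets_ex_less_count) auto
    then show ?thesis
      unfolding lambda_hat_le_iff[OF \<open>n \<ge> 1\<close>] by (rule sets.sets_Collect_neg)
  qed
  have L: "real n * ?L = real (card ({1..n} - I))"
    using \<open>n \<ge> 1\<close> by (simp add: false_null_proportion_def of_bool_def sum.If_cases I_def Int_def
        set_diff_eq conj_commute cong: conj_cong)
  then have nL: "real n * ?L = real n - real m"
    using I card_mono[OF _ I(2)] by (simp add: card_Diff_subset m_def of_nat_diff)
  have split: "(\<Sum>i\<in>{1..n}. of_bool (P i \<omega> \<le> t)) \<le> real n - real m + (\<Sum>i\<in>I. of_bool (P i \<omega> \<le> t))"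
    for \<omega> t
  proof -
    have "(\<Sum>i\<in>{1..n}. of_bool (P i \<omega> \<le> t) :: real)
        = (\<Sum>i\<in>{1..n} - I. of_bool (P i \<omega> \<le> t)) + (\<Sum>i\<in>I. of_bool (P i \<omega> \<le> t))"
      by (rule sum.subset_diff[OF I(2)]) simp
    moreover have "(\<Sum>i\<in>{1..n} - I. of_bool (P i \<omega> \<le> t) :: real) \<le> (\<Sum>i\<in>{1..n} - I. 1)"
      by (intro sum_mono) auto
    ultimately show ?thesis
      using L nL by simp
  qed
  \<comment> \<open>The deterministic part. The bound uses \<open>real n * \<beta> n\<close> rather
    than \<open>real m * \<beta> m\<close> so that it also serves \<open>m = 0\<close>, where
    \<open>\<beta> 0\<close> is unconstrained.\<close>
  have goodI: "\<omega> \<in> ?good"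
    if \<omega>: "\<omega> \<in> space M" and null: "\<And>t. t \<in> {0<..<1} \<Longrightarrow>
      (\<Sum>i\<in>I. of_bool (P i \<omega> \<le> t)) \<le> real m * t + real n * \<beta> n * \<delta> t" for \<omega>
  proof -
    have "\<not> real n * (t + \<beta> n * \<delta> t + ?L * (1 - t)) < (\<Sum>i\<in>{1..n}. of_bool (P i \<omega> \<le> t))"
      if "t \<in> {0<..<1}" for t
    proof -
      have "real n * (t + \<beta> n * \<delta> t + ?L * (1 - t))
          = real n * t + real n * \<beta> n * \<delta> t + (real n * ?L) * (1 - t)"
        by (simp add: algebra_simps)
      also have "\<dots> = real n - real m + (real m * t + real n * \<beta> n * \<delta> t)"
        unfolding nL by (simp add: algebra_simps)
      finally show ?thesis
        using split[of \<omega> t] null[OF that] by linarith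
    qed
    with \<omega> show ?thesis
      by (auto simp: lambda_hat_le_iff[OF \<open>n \<ge> 1\<close>])
  qed
  have \<delta>: "\<delta> t > 0" if "t \<in> {0<..<1}" for t
    using assms(4) that by (simp add: bounding_function_def)
  show ?thesis
  proof (cases "m = 0")
    case True
    have "\<beta> n \<ge> 0"
      using assms by (intro bounding_sequence_nonneg)
    \<comment> \<open>With \<open>I\<close> empty, the condition of \<open>goodI\<close> reads 0
      \<le> \<open>real n * \<beta> n * \<delta> t\<close>, so every outcome is good.\<close>
    then have "space M \<subseteq> ?good"
      using True \<delta> I by (intro subsetI goodI) (auto simp: m_def less_imp_le)
    then have "?good = space M" by blast
    then show ?thesis
      using \<open>0 < \<alpha>\<close> by (simp only: prob_space)
  next
    case False
    then have m: "m \<ge> 1" by simp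
    have "m \<le> n"
      using card_mono[OF _ I(2)] by (simp add: m_def)
    then have mono: "real m * \<beta> m \<le> real n * \<beta> n"
      using assms(5) m by (auto simp: bounding_sequence_def elim!: mono_onD)
    obtain f where f: "bij_betw f {1..m} I"
      using ex_bij_betw_nat_finite_1[OF I(1)] by (auto simp: m_def)
    define X where "X = (\<lambda>j. P (f j))"
    have fI: "f j \<in> I" if "j \<in> {1..m}" for j
      using f that by (auto simp: bij_betw_def)
    have "indep_vars (\<lambda>_. borel) P (f ` {1..m})"
      using assms(9) I(2) f by (auto simp: bij_betw_def intro: indep_vars_subset)
    from indep_vars_reindex[OF this] f have "indep_vars (\<lambda>_. borel) X {1..m}"
      by (simp add: X_def bij_betw_def)
    moreover have "distr M borel (X j) = uniform_measure lborel {0..1}" if "j \<in> {1..m}" for j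
      using fI[OF that] assms(10)[of "f j"] pvalue_model_null[OF assms(1)] by (simp add: X_def I_def)
    ultimately have law:
      "distr M (PiM {1..m} (\<lambda>_. borel)) (\<lambda>\<omega>. \<lambda>i\<in>{1..m}. X i \<omega>) = uniform_sample m"
      using m by (intro distr_uniform_sample)
    have X: "X j \<in> borel_measurable M" if "j \<in> {1..m}" for j
      using fI[OF that] I(2) rv by (auto simp: X_def)
    have sets_US: "sets (uniform_sample m) = sets (PiM {1..m} (\<lambda>_. borel))"
      unfolding law[symmetric] by simp
    define bad where "bad = {x \<in> space (uniform_sample m). V_stat m \<delta> x > ereal (\<beta> m)}"
    let ?X = "\<lambda>\<omega>. \<lambda>i\<in>{1..m}. X i \<omega>"
    have measX: "?X \<in> measurable M (PiM {1..m} (\<lambda>_. borel))"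
      using X by (intro measurable_restrict) auto
    have bad: "bad \<in> sets (PiM {1..m} (\<lambda>_. borel))"
      unfolding bad_def sets_US[symmetric] using sets_V_stat_gt[OF assms(4) m] .
    have "prob (?X -` bad \<inter> space M) = measure (uniform_sample m) bad"
      unfolding law[symmetric] by (subst measure_distr[OF measX bad]) simp
    also have "\<dots> < \<alpha>"
      using assms(5) m by (auto simp: bounding_sequence_def bad_def)
    finally have "1 - \<alpha> \<le> prob (space M - (?X -` bad \<inter> space M))"
      using measurable_sets[OF measX bad] by (simp add: prob_compl)
    also have "\<dots> \<le> prob ?good"
    proof (intro finite_measure_mono good subsetI goodI)
      fix \<omega> t assume \<omega>: "\<omega> \<in> space M - (?X -` bad \<inter> space M)" and t: "t \<in> {0<..<1::real}"
      \<comment> \<open>\<open>bad\<close> lies within the sample space, so membership in that space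
        is needed to conclude from \<open>?X \<omega>\<close> not being in \<open>bad\<close> that
        the bound holds.\<close>
      have "?X \<omega> \<in> space (uniform_sample m)"
        using measurable_space[OF measX, of \<omega>] \<omega> sets_eq_imp_space_eq[OF sets_US] by simp
      then have "\<not> V_stat m \<delta> (?X \<omega>) > ereal (\<beta> m)"
        using \<omega> by (auto simp: bad_def)
      then have "(\<Sum>j\<in>{1..m}. of_bool (?X \<omega> j \<le> t)) \<le> real m * (t + \<beta> m * \<delta> t)"
        using t by (auto simp: V_stat_gt_iff[OF assms(4) m] not_less)
      moreover have "(\<Sum>j\<in>{1..m}. of_bool (?X \<omega> j \<le> t) :: real) = (\<Sum>i\<in>I. of_bool (P i \<omega> \<le> t))"
        by (subst sum.reindex_bij_betw[OF f, symmetric]) (simp add: X_def)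
      moreover have "real m * \<beta> m * \<delta> t \<le> real n * \<beta> n * \<delta> t"
        using mono \<delta>[OF t] by (intro mult_right_mono) auto
      ultimately show "(\<Sum>i\<in>I. of_bool (P i \<omega> \<le> t)) \<le> real m * t + real n * \<beta> n * \<delta> t"
        by (simp add: algebra_simps)
    qed auto
    finally show ?thesis .
  qed
qed

end
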